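(* For every $n\ge1$, the map $\phi$ defined in the context is a bijection from the set $\mathcal{R}_n$ of restricted ascent sequences of length $n$ to the set of permutations of $\{1,\ldots,n\}$ avoiding $231$, and $\operatorname{asc}(\mathbf{x})=\operatorname{des}(\phi(\mathbf{x}))$ for every $\mathbf{x}\in\mathcal{R}_n$. Consequently, the distribution of the number of ascents on the set of ascent sequences of length $n$ avoiding $021$ (equivalently, on $\mathcal{R}_n$) is given by the Narayana numbers: for $0\le k\le n-1$, the number of such sequences with exactly $k$ ascents is $N(n,k+1)=\frac1n\binom{n}{k+1}\binom{n}{k}$.
   Context: An ascent sequence is a finite sequence $x_1\ldots x_n$ of nonnegative integers with $x_1=0$ and $x_i\le \operatorname{asc}(x_1\ldots x_{i-1})+1$ for $1<i\le n$, where $\operatorname{asc}(y_1\ldots y_k)$ is the number of indices $j$ with $y_j<y_{j+1}$; for a permutation $\pi$, $\operatorname{des}(\pi)$ is the number of $j$ with $\pi(j)>\pi(j+1)$. A sequence avoids $021$ if there are no $i_1<i_2<i_3$ with $x_{i_1}<x_{i_3}<x_{i_2}$; a permutation avoids $231$ if there are no $i_1<i_2<i_3$ with $\pi(i_3)<\pi(i_1)<\pi(i_2)$. A restricted ascent sequence is an ascent sequence with $x_i\ge \max(x_1,\ldots,x_{i-1})-1$ for all $2\le i\le n$. A letter $x_j$ is maximal if $x_j=\operatorname{asc}(x_1\ldots x_{j-1})+1$, and $x_1$ is also declared maximal. If $x_j$ is maximal and $x_j=x_{j+1}=\cdots=x_{j+k}$ with $k\ge1$ and either $j+k=n$ or $x_{j+k+1}\ne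 x_j$, then $x_j$ is repeated and $x_{j+k}$ is its last repetition; otherwise $x_j$ is its own last repetition. Define $\omega(\mathbf{y},I)$ for a restricted ascent sequence $\mathbf{y}$ and an integer interval $I$ of the same length: $\omega(\varepsilon,\emptyset)=\varepsilon$ (empty word); for nonempty $\mathbf{y}$, let $m$ be the last repetition of the rightmost maximal letter of $\mathbf{y}$, write $\mathbf{y}=LmR$ (with $L$ the part before that position, of length $\ell$, and $R$ the part after it), and let $\overline{R}$ be obtained from $R$ by subtracting the first letter of $R$ from each letter of $R$ (so $\overline{R}=\varepsilon$ if $R=\varepsilon$; $\overline R$ is again a restricted ascent sequence). Then, with $\oplus$ denoting concatenation, $\omega(LmR,[a,b])=a\oplus\omega(L,[a+1,a+\ell])\oplus\omega(\overline{R},[a+\ell+1,b])$ if the rightmost maximal letter of $\mathbf{y}$ is repeated, and $\omega(LmR,[a,b])=(a+\ell)\oplus\omega(L,[a,a+\ell-1])\oplus\omega(\overline{R},[a+\ell+1,b])$ otherwise. Finally $\phi(\mathbf{x})=\omega(\mathbf{x},[1,n])$ for $\mathbf{x}$ of length $n$. The Narayana numbers are $N(n,k)=\frac1n\binom{n}{k}\binom{n}{k-1}$. *)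

theory Defs
  imports Complex_Main "HOL-Combinatorics.Multiset_Permutations"
begin

text \<open>
  Words are lists, so positions are 0-based: \<open>xs ! j\<close> is the letter $x_{j+1}$, and
  \<open>take j xs\<close> is the prefix strictly before it. Permutations of $\{1,\ldots,n\}$ are in
  one-line notation, i.e. elements of \<open>permutations_of_set {1..n}\<close>.
\<close>

definition asc :: "nat list \<Rightarrow> nat" where
  "asc xs = card {j. Suc j < length xs \<and> xs ! j < xs ! Suc j}"

definition des :: "nat list \<Rightarrow> nat" where
  "des xs = card {j. Suc j < length xs \<and> xs ! j > xs ! Suc j}"

text \<open>The empty word counts as an ascent sequence; it occurs in the recursion for \<open>omega\<close>.\<close>

definition ascent_seq :: "nat list \<Rightarrow> bool" where
  "ascent_seq xs \<longleftrightarrow>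
     (xs \<noteq> [] \<longrightarrow> xs ! 0 = 0) \<and>
     (\<forall>i. 0 < i \<and> i < length xs \<longrightarrow> xs ! i \<le> asc (take i xs) + 1)"

definition avoids_021 :: "nat list \<Rightarrow> bool" where
  "avoids_021 xs \<longleftrightarrow>
     \<not> (\<exists>i1 i2 i3. i1 < i2 \<and> i2 < i3 \<and> i3 < length xs \<and>
          xs ! i1 < xs ! i3 \<and> xs ! i3 < xs ! i2)"

definition avoids_231 :: "nat list \<Rightarrow> bool" where
  "avoids_231 p \<longleftrightarrow>
     \<not> (\<exists>i1 i2 i3. i1 < i2 \<and> i2 < i3 \<and> i3 < length p \<and>
          p ! i3 < p ! i1 \<and> p ! i1 < p ! i2)"

text \<open>The bound $x_i \ge \max(x_1,\ldots,x_{i-1}) - 1$ is written without subtraction.\<close>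

definition restricted_ascent_seq :: "nat list \<Rightarrow> bool" where
  "restricted_ascent_seq xs \<longleftrightarrow>
     ascent_seq xs \<and>
     (\<forall>i. 0 < i \<and> i < length xs \<longrightarrow> Max (set (take i xs)) \<le> xs ! i + 1)"

definition maximal_at :: "nat list \<Rightarrow> nat \<Rightarrow> bool" where
  "maximal_at xs j \<longleftrightarrow> j < length xs \<and> (j = 0 \<or> xs ! j = asc (take j xs) + 1)"

text \<open>\<open>repeats xs j k\<close>: the letter at \<open>j\<close> is maximal and is followed by exactly \<open>k \<ge> 1\<close>
  further copies of itself.\<close>

definition repeats :: "nat list \<Rightarrow> nat \<Rightarrow> nat \<Rightarrow> bool" where
  "repeats xs j k \<longleftrightarrow>
     maximal_at xs j \<and> 1 \<le> k \<and> j + k < length xs \<and>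
     (\<forall>i\<le>k. xs ! (j + i) = xs ! j) \<and>
     (Suc (j + k) = length xs \<or> xs ! Suc (j + k) \<noteq> xs ! j)"

definition repeated :: "nat list \<Rightarrow> nat \<Rightarrow> bool" where
  "repeated xs j \<longleftrightarrow> (\<exists>k. repeats xs j k)"

definition last_repetition :: "nat list \<Rightarrow> nat \<Rightarrow> nat" where
  "last_repetition xs j = (if repeated xs j then j + (THE k. repeats xs j k) else j)"

definition rightmost_maximal :: "nat list \<Rightarrow> nat" where
  "rightmost_maximal xs = Max {j. maximal_at xs j}"

lemma repeats_unique:
  assumes "repeats xs j k" and "repeats xs j k'"
  shows "k = k'"
proof -
  have False if "repeats xs j a" and "repeats xs j b" and "a < b" for a b
  proof -
    from that have "Suc a \<le> b" by simp
    with that(2) have "xs ! (j + Suc a) = xs ! j" and "j + Suc a < length xs"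
      unfolding repeats_def by (blast, linarith)
    with that(1) show False unfolding repeats_def by auto
  qed
  with assms show ?thesis by (meson nat_neq_iff)
qed

lemma last_repetition_less:
  assumes "j < length xs"
  shows "last_repetition xs j < length xs"
proof (cases "repeated xs j")
  case True
  then obtain k where k: "repeats xs j k" unfolding repeated_def by blast
  then have "(THE k. repeats xs j k) = k" by (blast intro: the_equality repeats_unique)
  with True have "last_repetition xs j = j + k" by (simp add: last_repetition_def)
  with k show ?thesis by (simp add: repeats_def)
next
  case False
  with assms show ?thesis by (simp add: last_repetition_def)
qed

lemma rightmost_maximal_less:
  assumes "xs \<noteq> []"
  shows "rightmost_maximal xs < length xs"
proof -
  have "finite {j. maximal_at xs j}"
    by (rule finite_subset[of _ "{..<length xs}"]) (auto simp: maximal_at_def)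
  moreover have "0 \<in> {j. maximal_at xs j}" using assms by (simp add: maximal_at_def)
  ultimately have "rightmost_maximal xs \<in> {j. maximal_at xs j}"
    unfolding rightmost_maximal_def by (intro Max_in) auto
  then show ?thesis by (simp add: maximal_at_def)
qed

text \<open>Subtract the first letter from every letter. In \<open>omega\<close> this is applied to the part
  of a restricted ascent sequence after the last repetition of its rightmost maximal letter, whose
  first letter is a minimum, so that the subtraction on \<open>nat\<close> is not truncated.\<close>

definition shift_down :: "nat list \<Rightarrow> nat list" where
  "shift_down R = map (\<lambda>r. r - hd R) R"

text \<open>\<open>omega ys a\<close> is $\omega(\mathbf{y},[a,b])$: the interval has as many elements as
  \<open>ys\<close> has letters, hence $b = a + |\mathbf{y}| - 1$ is not passed as an argument.\<close>

function omega :: "nat list \<Rightarrow> nat \<Rightarrow> nat list" where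
  "omega ys a =
     (if ys = [] then []
      else
        let j = rightmost_maximal ys;
            l = last_repetition ys j;
            L = take l ys;
            R = drop (Suc l) ys
        in if repeated ys j
           then [a] @ omega L (a + 1) @ omega (shift_down R) (a + l + 1)
           else [a + l] @ omega L a @ omega (shift_down R) (a + l + 1))"
  by pat_completeness auto
termination
  by (relation "measure (\<lambda>(ys, a). length ys)")
     (auto simp: shift_down_def last_repetition_less rightmost_maximal_less)

declare omega.simps [simp del]

definition phi :: "nat list \<Rightarrow> nat list" where
  "phi xs = omega xs 1"

definition narayana :: "nat \<Rightarrow> nat \<Rightarrow> real" where
  "narayana n k = 1 / real n * real (n choose k) * real (n choose (k - 1))"

end

theory Submission
  imports Defs "HOL-Computational_Algebra.Polynomial"
begin

text \<open>
  A nonempty restricted ascent sequence is uniquely $L\, m^{c+1}\, (R + m - 1)$, where the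
  displayed $m$s are the rightmost maximal letter and its repetitions, $m = \mathrm{asc}(L) + 1$
  ($m = 0$ if $L$ is empty), and $L$ and $R$ are restricted ascent sequences, $R$ being empty if
  $L$ is. Deleting one copy of a repeated $m$ deletes the first entry of the image under
  \<open>omega\<close>. So both kinds of objects are encoded by binary trees: a node with empty left subtree
  duplicates $m$ and prepends the minimum to the permutation, while a node with nonempty left
  subtree glues $L$ and $R$ around a new $m$ and starts the permutation with the maximum of the
  first block. Nodes of the second kind account for the ascents and the descents.

  The number of such nodes has a generating polynomial satisfying the first-return recursion of
  weighted Motzkin paths, which are counted by reflection. Finally, replacing every letter below
  the running maximum $M$ by $0$ instead of $M - 1$ turns restricted ascent sequences into the
  ascent sequences avoiding 021 and preserves ascents.
\<close>

section \<open>Adjacent letters\<close>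

text \<open>Common form of \<open>asc\<close> and \<open>des\<close>, so that the cons and append
  rules are proved only once.\<close>

definition adj :: "(nat \<Rightarrow> nat \<Rightarrow> bool) \<Rightarrow> nat list \<Rightarrow> nat" where
  "adj P xs = card {j. Suc j < length xs \<and> P (xs ! j) (xs ! Suc j)}"

lemma asc_adj: "asc = adj (<)"
  by (simp add: fun_eq_iff asc_def adj_def)

lemma des_adj: "des = adj (>)"
  by (simp add: fun_eq_iff des_def adj_def)

lemma adj_Nil [simp]: "adj P [] = 0"
  by (simp add: adj_def)

lemma adj_singleton [simp]: "adj P [x] = 0"
  by (simp add: adj_def)

lemma adj_Cons:
  "adj P (x # ys) = (if ys \<noteq> [] \<and> P x (hd ys) then 1 else 0) + adj P ys"
proof -
  let ?S = "{j. Suc j < length ys \<and> P (ys ! j) (ys ! Suc j)}"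
  let ?T = "{j. Suc j < length (x # ys) \<and> P ((x # ys) ! j) ((x # ys) ! Suc j)}"
  have fin: "finite ?S" by (rule finite_subset[of _ "{..<length ys}"]) auto
  have T: "?T = (if ys \<noteq> [] \<and> P x (hd ys) then {0} else {}) \<union> Suc ` ?S"
  proof (rule set_eqI)
    fix j show "j \<in> ?T \<longleftrightarrow> j \<in> (if ys \<noteq> [] \<and> P x (hd ys) then {0} else {}) \<union> Suc ` ?S"
      by (cases j) (auto simp: hd_conv_nth)
  qed
  have "card (Suc ` ?S) = card ?S" by (simp add: card_image)
  with fin show ?thesis unfolding adj_def T by auto
qed

lemma adj_append:
  "adj P (xs @ ys) = adj P xs + adj P ys +
     (if xs \<noteq> [] \<and> ys \<noteq> [] \<and> P (last xs) (hd ys) then 1 else 0)"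
  by (induction xs) (auto simp: adj_Cons)

lemma asc_simps [simp]: "asc [] = 0" "asc [x] = 0"
  by (simp_all add: asc_adj)

lemma asc_append:
  "asc (xs @ ys) = asc xs + asc ys +
     (if xs \<noteq> [] \<and> ys \<noteq> [] \<and> last xs < hd ys then 1 else 0)"
  by (simp add: asc_adj adj_append)

lemma asc_replicate [simp]: "asc (replicate k x) = 0"
  by (induction k) (auto simp: asc_adj adj_Cons)

lemma asc_map_add [simp]: "asc (map (\<lambda>r. r + c) xs) = asc xs"
  by (simp add: asc_def cong: conj_cong)

section \<open>Appending a letter\<close>

text \<open>The classes of words below constrain a letter by the prefix before it. This turns each
  of them into a rule for appending a letter, as the inductions run from the right.\<close>

lemma all_nth_snoc:
  "(\<forall>i. 0 < i \<and> i < length (xs @ [x]) \<longrightarrow> P (take i (xs @ [x])) ((xs @ [x]) ! i)) \<longleftrightarrow>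
   (\<forall>i. 0 < i \<and> i < length xs \<longrightarrow> P (take i xs) (xs ! i)) \<and> (xs \<noteq> [] \<longrightarrow> P xs x)"
  by (auto simp: nth_append less_Suc_eq)

lemma ascent_seq_snoc:
  "ascent_seq (xs @ [x]) \<longleftrightarrow> (if xs = [] then x = 0 else ascent_seq xs \<and> x \<le> asc xs + 1)"
  unfolding ascent_seq_def all_nth_snoc[where P = "\<lambda>ys y. y \<le> asc ys + 1"]
  by (auto simp: nth_append)

lemma restricted_snoc:
  "restricted_ascent_seq (xs @ [x]) \<longleftrightarrow>
     (if xs = [] then x = 0
      else restricted_ascent_seq xs \<and> x \<le> asc xs + 1 \<and> Max (set xs) \<le> x + 1)"
  unfolding restricted_ascent_seq_def ascent_seq_snoc
    all_nth_snoc[where P = "\<lambda>ys y. Max (set ys) \<le> y + 1"]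
  by auto

lemma ascent_seq_singleton [simp]: "ascent_seq [x] \<longleftrightarrow> x = 0"
  by (simp add: ascent_seq_def)

lemma restricted_singleton [simp]: "restricted_ascent_seq [x] \<longleftrightarrow> x = 0"
  by (simp add: restricted_ascent_seq_def)

lemma restricted_Nil [simp]: "restricted_ascent_seq []"
  by (simp add: restricted_ascent_seq_def ascent_seq_def)

lemma restricted_hd: "restricted_ascent_seq xs \<Longrightarrow> xs \<noteq> [] \<Longrightarrow> hd xs = 0"
  by (simp add: restricted_ascent_seq_def ascent_seq_def hd_conv_nth)

lemma restricted_appendD: "restricted_ascent_seq (xs @ ys) \<Longrightarrow> restricted_ascent_seq xs"
  by (induction ys rule: rev_induct)
     (auto simp: restricted_snoc simp flip: append_assoc split: if_splits)

text \<open>By induction, a letter exceeding \<open>asc ys\<close> also exceeds the last letter of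
  \<open>ys\<close>, so it adds an ascent itself.\<close>

lemma ascent_seq_le_asc: "ascent_seq xs \<Longrightarrow> x \<in> set xs \<Longrightarrow> x \<le> asc xs"
proof (induction xs arbitrary: x rule: rev_induct)
  case (snoc y ys)
  show ?case
  proof (cases "ys = []")
    case False
    with snoc.prems have "ascent_seq ys" "y \<le> asc ys + 1" by (auto simp: ascent_seq_snoc)
    moreover from False have "last ys \<in> set ys" by simp
    ultimately show ?thesis using snoc.IH[of x] snoc.IH[of "last ys"] snoc.prems(2) False
      by (auto simp: asc_append)
  qed (use snoc in simp)
qed simp

lemma restricted_Max_le_asc:
  "restricted_ascent_seq xs \<Longrightarrow> xs \<noteq> [] \<Longrightarrow> Max (set xs) \<le> asc xs"
  by (auto simp: restricted_ascent_seq_def intro: ascent_seq_le_asc)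

section \<open>Words around the rightmost maximal letter\<close>

text \<open>The value of a maximal letter placed right after \<open>L\<close>; the case of empty
  \<open>L\<close> is the convention that the leading 0 is maximal.\<close>

definition new_max :: "nat list \<Rightarrow> nat" where
  "new_max L = (if L = [] then 0 else asc L + 1)"

definition block :: "nat list \<Rightarrow> nat \<Rightarrow> nat list" where
  "block L c = L @ replicate (Suc c) (new_max L)"

text \<open>For nonempty \<open>L\<close> the offset is the least letter allowed after the block. A
  nonempty restricted \<open>R\<close> starts with 0, so it continues with
  \<open>new_max L - 1\<close> and ends the run of copies.\<close>

definition glue :: "nat list \<Rightarrow> nat \<Rightarrow> nat list \<Rightarrow> nat list" where
  "glue L c R = block L c @ map (\<lambda>r. r + (new_max L - 1)) R"

text \<open>After a word of zeros only another 0 or the maximal letter 1 may follow, which leaves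
  nothing for \<open>R\<close> when \<open>L\<close> is empty.\<close>

definition gluable :: "nat list \<Rightarrow> nat list \<Rightarrow> bool" where
  "gluable L R \<longleftrightarrow>
     restricted_ascent_seq L \<and> restricted_ascent_seq R \<and> (L = [] \<longrightarrow> R = [])"

lemma block_simps [simp]:
  "block L c \<noteq> []" "length (block L c) = length L + Suc c" "last (block L c) = new_max L"
  by (simp_all add: block_def del: replicate_Suc)

lemma block_Suc: "block L (Suc c) = block L c @ [new_max L]"
  by (simp add: block_def replicate_append_same)

lemma block_0: "block L 0 = L @ [new_max L]"
  by (simp add: block_def)

lemma glue_Nil: "glue L c [] = block L c"
  by (simp add: glue_def)

lemma length_glue [simp]: "length (glue L c R) = length L + Suc c + length R"
  by (simp add: glue_def)

lemma glue_not_Nil [simp]: "glue L c R \<noteq> []"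
  by (simp add: glue_def)

text \<open>All letters of \<open>L\<close> are at most \<open>asc L\<close>, so exactly one ascent
  leads into a block with nonempty \<open>L\<close>.\<close>

lemma asc_block: "restricted_ascent_seq L \<Longrightarrow> asc (block L c) = new_max L"
proof (induction c)
  case 0
  have "last L \<le> asc L" if "L \<noteq> []"
    using 0 that by (auto simp: restricted_ascent_seq_def intro: ascent_seq_le_asc)
  then show ?case by (cases "L = []") (simp_all add: block_0 asc_append new_max_def)
qed (auto simp: block_Suc asc_append)

lemma Max_block:
  assumes "restricted_ascent_seq L"
  shows "Max (set (block L c)) = new_max L"
proof -
  have "x \<le> new_max L" if "x \<in> set L" for x
    using ascent_seq_le_asc[of L x] assms that
    by (auto simp: new_max_def restricted_ascent_seq_def)
  then show ?thesis by (intro Max_eqI) (auto simp: block_def)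
qed

lemma restricted_block: "restricted_ascent_seq L \<Longrightarrow> restricted_ascent_seq (block L c)"
proof (induction c)
  case 0
  show ?case
  proof (cases "L = []")
    case True
    then show ?thesis
      unfolding block_0 restricted_snoc by (simp add: new_max_def)
  next
    case False
    with restricted_Max_le_asc[OF 0 False] 0 show ?thesis
      unfolding block_0 restricted_snoc by (simp add: new_max_def del: Max.bounded_iff)
  qed
next
  case (Suc c)
  then show ?case
    unfolding block_Suc restricted_snoc by (simp add: asc_block Max_block)
qed

lemma asc_glue:
  assumes "gluable L R"
  shows "asc (glue L c R) = new_max L + asc R"
proof (cases "R = []")
  case False
  with assms have "hd R = 0" "L \<noteq> []" by (auto simp: gluable_def restricted_hd)
  with assms False show ?thesis
    by (simp add: glue_def asc_append asc_block gluable_def hd_map new_max_def)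
qed (use assms in \<open>simp add: glue_Nil asc_block gluable_def\<close>)

lemma Max_map_add:
  "xs \<noteq> [] \<Longrightarrow> Max (set (map (\<lambda>r. r + c) xs)) = Max (set xs) + (c::nat)"
  using Max_add_commute[of "set xs" "\<lambda>x. x" c] by simp

lemma Max_glue:
  assumes "restricted_ascent_seq L" "R \<noteq> []"
  shows "Max (set (glue L c R)) = max (new_max L) (Max (set R) + (new_max L - 1))"
proof -
  have "Max (set (block L c) \<union> set (map (\<lambda>r. r + (new_max L - 1)) R)) =
    max (Max (set (block L c))) (Max (set (map (\<lambda>r. r + (new_max L - 1)) R)))"
    using assms(2) by (intro Max_Un) (simp_all add: block_def)
  with Max_block[OF assms(1), of c] Max_map_add[OF assms(2), of "new_max L - 1"]
  show ?thesis by (simp add: glue_def del: set_map)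
qed

section \<open>Decomposition of a restricted ascent sequence\<close>

lemma glue_snoc: "glue L c (R @ [x]) = glue L c R @ [x + (new_max L - 1)]"
  by (simp add: glue_def)

text \<open>Gluing adds \<open>new_max L\<close> to the number of ascents but only
  \<open>new_max L - 1\<close> to the letters of \<open>R\<close>. Hence the upper bound for
  extending \<open>R\<close> becomes non-maximality in the glued word, while the lower bounds
  correspond directly.\<close>

lemma restricted_glue_snoc:
  assumes "gluable L R" "L \<noteq> []" "R = [] \<Longrightarrow> x = 0"
  shows "restricted_ascent_seq (glue L c R @ [x + (new_max L - 1)]) \<and>
      x + (new_max L - 1) \<le> asc (glue L c R) \<longleftrightarrow>
    restricted_ascent_seq (glue L c R) \<and> restricted_ascent_seq (R @ [x])"
proof -
  have m: "new_max L \<ge> 1" using assms by (simp add: new_max_def)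
  show ?thesis
  proof (cases "R = []")
    case True
    with assms m show ?thesis
      using Max_block[of L c] asc_block[of L c]
      by (auto simp: restricted_snoc glue_Nil gluable_def)
  next
    case False
    with assms m show ?thesis
      using Max_glue[of L R c] asc_glue[of L R c]
      by (auto simp: restricted_snoc gluable_def simp del: Max.bounded_iff)
  qed
qed

lemma restricted_glue: "gluable L R \<Longrightarrow> restricted_ascent_seq (glue L c R)"
proof (induction R rule: rev_induct)
  case Nil
  then show ?case by (simp add: glue_Nil restricted_block gluable_def)
next
  case (snoc x R)
  then have "gluable L R" "L \<noteq> []" "restricted_ascent_seq (R @ [x])"
    by (auto simp: gluable_def restricted_snoc split: if_splits)
  moreover have "x = 0" if "R = []" using that snoc.prems by (simp add: gluable_def)
  ultimately show ?case using restricted_glue_snoc[of L R x c] snoc.IH by (auto simp: glue_snoc)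
qed

text \<open>Induction from the right: a maximal new letter makes the old word the new
  \<open>L\<close>, a further copy right after the block increases \<open>c\<close>, and any other
  letter is appended to \<open>R\<close>.\<close>

lemma glue_cases:
  assumes "restricted_ascent_seq y" "y \<noteq> []"
  obtains L c R where "gluable L R" "y = glue L c R"
proof -
  from assms have "\<exists>L c R. gluable L R \<and> y = glue L c R"
  proof (induction y rule: rev_induct)
    case (snoc x y)
    show ?case
    proof (cases "y = []")
      case True
      with snoc.prems have "y @ [x] = glue [] 0 []"
        by (simp add: restricted_snoc[of "[]", simplified] glue_Nil block_0 new_max_def)
      then show ?thesis by (metis gluable_def restricted_Nil)
    next
      case False
      with snoc.prems have y: "restricted_ascent_seq y" "x \<le> asc y + 1" "Max (set y) \<le> x + 1"
        by (auto simp: restricted_snoc)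
      with snoc.IH False obtain L c R where LR: "gluable L R" "y = glue L c R" by blast
      let ?m = "new_max L"
      consider "x = asc y + 1" | "x \<le> asc y" "R = []" "x = ?m"
        | "x \<le> asc y" "x + 1 \<ge> ?m" "x \<noteq> ?m \<or> R \<noteq> []"
      proof -
        have "?m \<le> x + 1"
        proof (cases "R = []")
          case True
          with y(3) LR Max_block[of L c] show ?thesis
            by (simp add: gluable_def glue_Nil del: Max.bounded_iff)
        next
          case False
          with y(3) LR Max_glue[of L R c] show ?thesis
            by (simp add: gluable_def del: Max.bounded_iff)
        qed
        with y(2) that show thesis by linarith
      qed
      then show ?thesis
      proof cases
        case 1
        with False have "y @ [x] = glue y 0 []" by (simp add: glue_Nil block_0 new_max_def)
        moreover from y(1) have "gluable y []" by (simp add: gluable_def)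
        ultimately show ?thesis by blast
      next
        case 2
        with LR(2) have "y @ [x] = glue L (Suc c) []" by (simp add: glue_Nil block_Suc)
        with 2 LR(1) show ?thesis by blast
      next
        case 3
        have "asc y = ?m + asc R" using LR by (simp add: asc_glue)
        \<comment> \<open>With \<open>L\<close> empty, \<open>asc y\<close>, \<open>x\<close> and
          \<open>?m\<close> would all be 0 and \<open>R\<close> empty, which case 3
          excludes.\<close>
        with 3 LR have "L \<noteq> []" by (auto simp: gluable_def new_max_def)
        then have "x = (x - (?m - 1)) + (?m - 1)" using 3 by (simp add: new_max_def)
        then obtain z where z: "x = z + (?m - 1)" by blast
        \<comment> \<open>With \<open>R\<close> empty, \<open>x\<close> is at most \<open>?m\<close>
          but different from it, which leaves only \<open>?m - 1\<close>.\<close>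
        have "z = 0" if "R = []"
          using 3 that z \<open>asc y = ?m + asc R\<close> by simp
        from restricted_glue_snoc[OF LR(1) \<open>L \<noteq> []\<close> this, of c] 3 snoc.prems LR(2) z
        have "restricted_ascent_seq (R @ [z])" by simp
        with LR(1) \<open>L \<noteq> []\<close> have "gluable L (R @ [z])" by (simp add: gluable_def)
        moreover have "y @ [x] = glue L c (R @ [z])" using LR(2) z by (simp add: glue_snoc)
        ultimately show ?thesis by blast
      qed
    qed
  qed simp
  with that show thesis by blast
qed

section \<open>Position of the rightmost maximal letter and of its last repetition\<close>

lemma take_glue:
  "take (length L + Suc k) (glue L c R) =
     (if k \<le> c then block L k else block L c @ map (\<lambda>r. r + (new_max L - 1)) (take (k - c) R))"
proof (cases "k \<le> c")
  case True
  then show ?thesis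
    by (simp add: glue_def block_def min_def del: replicate_Suc)
next
  case False
  then show ?thesis by (simp add: glue_def take_map)
qed

lemma nth_glue:
  "glue L c R ! (length L + k) =
     (if k \<le> c then new_max L else (R ! (k - Suc c) + (new_max L - 1)))"
  if "k < Suc c + length R"
proof (cases "k \<le> c")
  case True
  then show ?thesis by (simp add: glue_def block_def nth_append del: replicate_Suc)
next
  case False
  with that show ?thesis by (auto simp: glue_def nth_append)
qed

lemma maximal_at_glue: "maximal_at (glue L c R) (length L)"
  using nth_glue[of 0 c R L]
  by (auto simp: maximal_at_def glue_def block_def new_max_def)

text \<open>Beyond the first \<open>m = new_max L\<close> a maximal letter would have to exceed the
  number of ascents so far. Further copies of \<open>m\<close> only equal it, and a letter of
  \<open>R\<close> after a prefix \<open>Q\<close> is at most \<open>asc Q + 1\<close>, hence at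
  most \<open>m + asc Q\<close> after the shift.\<close>

lemma rightmost_maximal_glue:
  assumes "gluable L R"
  shows "rightmost_maximal (glue L c R) = length L" (is "rightmost_maximal ?y = _")
proof -
  have "i \<le> length L" if i: "maximal_at ?y i" for i
  proof (rule ccontr)
    assume "\<not> i \<le> length L"
    then obtain k where k: "i = length L + Suc k" by (metis add_Suc_right less_imp_Suc_add not_le)
    from i k have lt: "Suc k < Suc c + length R" and
      eq: "?y ! i = asc (take i ?y) + 1" by (auto simp: maximal_at_def)
    show False
    proof (cases "k < c")
      case True
      with eq lt assms show False
        by (simp add: k nth_glue take_glue asc_block gluable_def flip: add_Suc_right)
    next
      case False
      define q where "q = k - c"
      have q: "q < length R" using False lt by (simp add: q_def)
      have g: "gluable L (take q R)"
        using assms restricted_appendD[of "take q R" "drop q R"] q by (auto simp: gluable_def)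
      have "take i ?y = glue L c (take q R)"
        using False by (auto simp: k take_glue glue_def q_def take_map)
      with asc_glue[OF g] have "asc (take i ?y) = new_max L + asc (take q R)" by simp
      moreover have "?y ! i = R ! q + (new_max L - 1)"
        using nth_glue[OF lt, of L] False by (simp add: k q_def)
      moreover have "R ! q \<le> asc (take q R) + 1"
        using assms q by (cases "q = 0")
          (auto simp: gluable_def restricted_ascent_seq_def ascent_seq_def)
      moreover have "new_max L \<ge> 1" using assms q by (auto simp: gluable_def new_max_def)
      ultimately show False using eq by simp
    qed
  qed
  moreover have "finite {j. maximal_at ?y j}"
    by (rule finite_subset[of _ "{..<length ?y}"]) (auto simp: maximal_at_def)
  ultimately show ?thesis
    unfolding rightmost_maximal_def using maximal_at_glue by (intro Max_eqI) auto
qed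

lemma glue_after_block:
  assumes "gluable L R"
  shows "Suc (length L + c) = length (glue L c R) \<or>
         glue L c R ! Suc (length L + c) \<noteq> new_max L"
proof (cases "R = []")
  case False
  with assms have "R ! 0 = 0" "new_max L \<ge> 1"
    by (auto simp: gluable_def new_max_def restricted_hd simp flip: hd_conv_nth)
  with False nth_glue[of "Suc c" c R L] show ?thesis by simp
qed simp

lemma repeats_glue:
  assumes "gluable L R" "c \<ge> 1"
  shows "repeats (glue L c R) (length L) c"
  unfolding repeats_def
  using assms maximal_at_glue[of L c R] glue_after_block[OF assms(1), of c] nth_glue[of 0 c R L]
  by (auto simp: nth_glue)

lemma not_repeated_glue:
  assumes "gluable L R"
  shows "\<not> repeated (glue L 0 R) (length L)"
proof
  assume "repeated (glue L 0 R) (length L)"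
  then obtain k where "repeats (glue L 0 R) (length L) k" by (auto simp: repeated_def)
  then have "length L + 1 < length (glue L 0 R)"
    "glue L 0 R ! (length L + 1) = glue L 0 R ! (length L + 0)"
    by (auto simp: repeats_def)
  with glue_after_block[OF assms, of 0] nth_glue[of 0 0 R L] show False by simp
qed

lemma last_repetition_glue:
  assumes "gluable L R"
  shows "last_repetition (glue L c R) (length L) = length L + c"
proof (cases "c = 0")
  case True
  with assms show ?thesis by (simp add: last_repetition_def not_repeated_glue)
next
  case False
  then have "repeats (glue L c R) (length L) c" using assms by (simp add: repeats_glue)
  moreover from this have "(THE k. repeats (glue L c R) (length L) k) = c"
    by (blast intro: repeats_unique)
  ultimately show ?thesis by (auto simp: last_repetition_def repeated_def)
qed

lemma take_glue_block: "take (length L + c) (glue L c R) = L @ replicate c (new_max L)"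
  by (simp add: glue_def block_def del: replicate_Suc)

lemma shift_down_glue:
  assumes "gluable L R"
  shows "shift_down (drop (Suc (length L + c)) (glue L c R)) = R"
proof (cases "R = []")
  case False
  with assms have "hd R = 0" by (simp add: gluable_def restricted_hd)
  with False show ?thesis
    by (simp add: glue_def shift_down_def hd_map comp_def)
qed (simp add: glue_def shift_down_def)

section \<open>The recursion for \<open>omega\<close> on glued words\<close>

lemma omega_Nil [simp]: "omega [] a = []"
  by (simp add: omega.simps)

lemma omega_glue_0:
  assumes "gluable L R"
  shows "omega (glue L 0 R) a = (a + length L) # omega L a @ omega R (Suc (a + length L))"
  using take_glue_block[of L 0 R] shift_down_glue[OF assms, of 0]
  by (subst omega.simps)
     (simp add: Let_def rightmost_maximal_glue last_repetition_glue not_repeated_glue assms)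

lemma omega_glue_Suc_block:
  assumes "gluable L R"
  shows "omega (glue L (Suc c) R) a =
    a # omega (block L c) (Suc a) @ omega R (Suc (Suc (a + length L + c)))"
proof -
  have "repeated (glue L (Suc c) R) (length L)"
    using repeats_glue[OF assms, of "Suc c"] by (auto simp: repeated_def)
  with take_glue_block[of L "Suc c" R] shift_down_glue[OF assms, of "Suc c"] show ?thesis
    by (subst omega.simps)
       (simp add: Let_def rightmost_maximal_glue last_repetition_glue assms block_def add.assoc)
qed

text \<open>In both cases of the recursion \<open>R\<close> fills the upper end of the interval
  independently of the rest. Splitting it off allows \<open>omega_glue_Suc\<close> to reattach it to
  the shortened block.\<close>

lemma omega_glue_block:
  assumes "gluable L R"
  shows "omega (glue L c R) a = omega (block L c) a @ omega R (a + length (block L c))"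
proof -
  have L: "gluable L []" using assms by (simp add: gluable_def)
  show ?thesis
    using omega_glue_0[OF assms] omega_glue_0[OF L]
      omega_glue_Suc_block[OF assms] omega_glue_Suc_block[OF L]
    by (cases c) (simp_all add: glue_Nil add.assoc)
qed

lemma omega_glue_Suc:
  assumes "gluable L R"
  shows "omega (glue L (Suc c) R) a = a # omega (glue L c R) (Suc a)"
  using omega_glue_Suc_block[OF assms] omega_glue_block[OF assms, of c "Suc a"]
  by (simp add: add.assoc)

section \<open>Binary trees\<close>

datatype tree = Leaf | Node tree tree

fun left_children :: "tree \<Rightarrow> nat" where
  "left_children Leaf = 0"
| "left_children (Node l r) = (if l = Leaf then 0 else 1) + left_children l + left_children r"

text \<open>One more copy of the rightmost maximal letter, described on the word itself so that
  \<open>word\<close> needs no choice of a decomposition.\<close>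

definition dup :: "nat list \<Rightarrow> nat list" where
  "dup y = (if y = [] then [0]
     else let l = last_repetition y (rightmost_maximal y) in take (Suc l) y @ drop l y)"

fun word :: "tree \<Rightarrow> nat list" where
  "word Leaf = []"
| "word (Node l r) = (if l = Leaf then dup (word r) else glue (word l) 0 (word r))"

text \<open>The recursion for \<open>omega\<close> carried over to trees: with an empty left subtree
  the first entry is the minimum \<open>a\<close>, so one clause covers both cases.\<close>

fun perm :: "tree \<Rightarrow> nat \<Rightarrow> nat list" where
  "perm Leaf a = []"
| "perm (Node l r) a = (a + size l) # perm l a @ perm r (Suc (a + size l))"

lemma dup_glue:
  assumes "gluable L R"
  shows "dup (glue L c R) = glue L (Suc c) R"
proof -
  have "take (Suc (length L + c)) (glue L c R) = block L c"
    using take_glue[of L c c R] by simp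
  moreover have "drop (length L + c) (glue L c R) =
      new_max L # map (\<lambda>r. r + (new_max L - 1)) R"
    by (simp add: glue_def block_def flip: replicate_append_same)
  moreover have "dup (glue L c R) =
      take (Suc (length L + c)) (glue L c R) @ drop (length L + c) (glue L c R)"
    by (simp add: dup_def Let_def rightmost_maximal_glue last_repetition_glue assms)
  ultimately show ?thesis by (simp add: glue_def block_Suc)
qed

lemma size_eq_0_tree [simp]: "size (t :: tree) = 0 \<longleftrightarrow> t = Leaf"
  by (cases t) auto

lemma dup_props:
  assumes "restricted_ascent_seq y"
  shows "restricted_ascent_seq (dup y)" "length (dup y) = Suc (length y)" "asc (dup y) = asc y"
    "omega (dup y) a = a # omega y (Suc a)"
proof -
  have "restricted_ascent_seq (dup y) \<and> length (dup y) = Suc (length y) \<and> asc (dup y) = asc y \<and>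
    omega (dup y) a = a # omega y (Suc a)"
  proof (cases "y = []")
    case True
    have "gluable [] []" by (simp add: gluable_def)
    moreover have "[0::nat] = glue [] 0 []" by (simp add: glue_Nil block_0 new_max_def)
    ultimately have "omega [0] a = [a]" using omega_glue_0[of "[]" "[]" a] by simp
    with True show ?thesis by (simp add: dup_def)
  next
    case False
    then obtain L c R where "gluable L R" "y = glue L c R" using assms glue_cases by blast
    then show ?thesis
      by (simp add: dup_glue restricted_glue asc_glue omega_glue_Suc)
  qed
  then show "restricted_ascent_seq (dup y)" "length (dup y) = Suc (length y)" "asc (dup y) = asc y"
    "omega (dup y) a = a # omega y (Suc a)" by auto
qed

lemma word_props:
  "restricted_ascent_seq (word t) \<and> length (word t) = size t \<and> asc (word t) = left_children t \<and>
   (\<forall>a. omega (word t) a = perm t a)"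
proof (induction t)
  case (Node l r)
  show ?case
  proof (cases "l = Leaf")
    case True
    with Node.IH(2) show ?thesis by (simp add: dup_props)
  next
    case False
    with Node.IH(1) have "word l \<noteq> []" by auto
    with Node.IH have g: "gluable (word l) (word r)" by (auto simp: gluable_def)
    then show ?thesis using Node.IH False \<open>word l \<noteq> []\<close>
      by (simp add: restricted_glue asc_glue omega_glue_0 new_max_def)
  qed
qed simp

text \<open>A word \<open>glue L 0 R\<close> with nonempty \<open>L\<close> comes from trees for
  \<open>L\<close> and \<open>R\<close>, and \<open>glue L (Suc d) R\<close> duplicates a letter of
  the shorter \<open>glue L d R\<close>.\<close>

lemma word_surj: "restricted_ascent_seq y \<Longrightarrow> \<exists>t. word t = y"
proof (induction y rule: length_induct)
  case (1 y)
  show ?case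
  proof (cases "y = []")
    case True
    then show ?thesis by (metis word.simps(1))
  next
    case False
    then obtain L c R where g: "gluable L R" "y = glue L c R" using 1 glue_cases by blast
    show ?thesis
    proof (cases c)
      case 0
      from g 0 have "length L < length y" "length R < length y" by auto
      with 1 g obtain l r where lr: "word l = L" "word r = R" by (metis gluable_def)
      show ?thesis
      proof (cases "L = []")
        case True
        with g 0 have "y = [0]" by (simp add: gluable_def glue_Nil block_0 new_max_def)
        then have "word (Node Leaf Leaf) = y" by (simp add: dup_def)
        then show ?thesis ..
      next
        case False
        then have "l \<noteq> Leaf" using lr by auto
        then have "word (Node l r) = y" using lr g 0 by simp
        then show ?thesis ..
      qed
    next
      case (Suc d)
      with g 1 obtain r where "word r = glue L d R"
        by (metis length_glue add_Suc add_Suc_right lessI restricted_glue)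
      with g Suc have "word (Node Leaf r) = y" by (simp add: dup_glue)
      then show ?thesis ..
    qed
  qed
qed

section \<open>Permutations avoiding 231\<close>

lemma length_perm [simp]: "length (perm t a) = size t"
  by (induction t arbitrary: a) auto

lemma perm_eq_Nil [simp]: "perm t a = [] \<longleftrightarrow> t = Leaf"
  by (cases t) auto

lemma set_perm: "set (perm t a) = {a..<a + size t}"
  by (induction t arbitrary: a) auto

lemma distinct_perm: "distinct (perm t a)"
  by (induction t arbitrary: a) (auto simp: set_perm)

text \<open>The first entry reveals the size of the left subtree, hence where to cut the remaining
  entries.\<close>

lemma inj_perm: "perm t a = perm t' a \<Longrightarrow> t = t'"
proof (induction t arbitrary: a t')
  case Leaf
  then show ?case by (cases t') auto
next
  case (Node l r)
  then show ?case by (cases t') auto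
qed

text \<open>The first entry exceeds all of \<open>perm l\<close> and lies below all of
  \<open>perm r\<close>, so the only new descent is the one into a nonempty
  \<open>perm l\<close>.\<close>

lemma des_perm: "des (perm t a) = left_children t"
proof (induction t arbitrary: a)
  case (Node l r)
  have hd: "hd (perm t a) \<in> {a..<a + size t}" if "t \<noteq> Leaf" for t a
    using that hd_in_set[of "perm t a"] by (simp add: set_perm)
  have last: "last (perm t a) \<in> {a..<a + size t}" if "t \<noteq> Leaf" for t a
    using that last_in_set[of "perm t a"] by (simp add: set_perm)
  show ?case
    using Node hd[of l a] last[of l a] hd[of r "Suc (a + size l)"]
    by (cases "l = Leaf"; cases "r = Leaf") (auto simp: des_adj adj_Cons adj_append hd_append)
qed (simp add: des_adj)

lemma avoids_231D:
  assumes "avoids_231 p" "i1 < i2" "i2 < i3" "i3 < length p" "p ! i3 < p ! i1"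
  shows "\<not> p ! i1 < p ! i2"
  using assms unfolding avoids_231_def by blast

lemma avoids_231_appendD:
  assumes "avoids_231 (p @ q)"
  shows "avoids_231 p" "avoids_231 q"
proof -
  show "avoids_231 p"
    unfolding avoids_231_def
  proof clarify
    fix i1 i2 i3 assume "i1 < i2" "i2 < i3" "i3 < length p" "p ! i3 < p ! i1" "p ! i1 < p ! i2"
    with avoids_231D[OF assms, of i1 i2 i3] show False by (simp add: nth_append)
  qed
  show "avoids_231 q"
    unfolding avoids_231_def
  proof clarify
    fix i1 i2 i3 assume "i1 < i2" "i2 < i3" "i3 < length q" "q ! i3 < q ! i1" "q ! i1 < q ! i2"
    with avoids_231D[OF assms, of "length p + i1" "length p + i2" "length p + i3"]
    show False by (simp add: nth_append)
  qed
qed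

lemma avoids_231_Cons_append:
  assumes "avoids_231 p" "avoids_231 q" "\<And>y. y \<in> set p \<Longrightarrow> y < x" "\<And>y. y \<in> set q \<Longrightarrow> x < y"
  shows "avoids_231 (x # p @ q)"
  unfolding avoids_231_def
proof clarify
  fix i1 i2 i3
  let ?w = "x # p @ q"
  assume i: "i1 < i2" "i2 < i3" "i3 < length ?w" "?w ! i3 < ?w ! i1" "?w ! i1 < ?w ! i2"
  have low: "?w ! i < x" if "0 < i" "i \<le> length p" for i
    using that assms(3) by (cases i) (auto simp: nth_append)
  have high: "x < ?w ! i" if "length p < i" "i < length ?w" for i
    using that assms(4) by (cases i) (auto simp: nth_append)
  show False
  proof (cases "i3 \<le> length p")
    case True
    show False
    proof (cases "i1 = 0")
      case True
      with i low[of i2] \<open>i3 \<le> length p\<close> show False by simp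
    next
      case False
      then obtain j1 j2 j3 where "i1 = Suc j1" "i2 = Suc j2" "i3 = Suc j3"
        using i by (cases i1; cases i2; cases i3) auto
      with i True avoids_231D[OF assms(1), of j1 j2 j3] show False by (simp add: nth_append)
    qed
  next
    case False
    \<comment> \<open>A pattern ending in \<open>q\<close> has its smallest entry above
      \<open>x\<close>, so it lies entirely in \<open>q\<close>.\<close>
    with i high[of i3] have "x < ?w ! i1" by simp
    with low[of i1] have "length p < i1" by (cases "i1 = 0") force+
    then obtain j1 where "i1 = Suc (length p + j1)" by (metis less_imp_Suc_add)
    moreover from \<open>length p < i1\<close> i obtain j2 where "i2 = Suc (length p + j2)"
      by (metis less_imp_Suc_add less_trans)
    moreover from \<open>length p < i1\<close> i obtain j3 where "i3 = Suc (length p + j3)"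
      by (metis less_imp_Suc_add less_trans)
    ultimately show False
      using i avoids_231D[OF assms(2), of j1 j2 j3] by (simp add: nth_append)
  qed
qed

lemma avoids_231_perm: "avoids_231 (perm t a)"
proof (induction t arbitrary: a)
  case (Node l r)
  then show ?case by (auto intro!: avoids_231_Cons_append simp: set_perm)
qed (simp add: avoids_231_def)

text \<open>An entry above \<open>x\<close> followed by one below \<open>x\<close> would form a 231
  with the leading \<open>x\<close>.\<close>

lemma avoids_231_Cons_split:
  assumes "avoids_231 (x # q)" "x \<notin> set q"
  shows "q = filter (\<lambda>y. y < x) q @ filter (\<lambda>y. x < y) q"
  using assms
proof (induction q rule: rev_induct)
  case (snoc z q)
  from snoc.prems avoids_231_appendD(1)[of "x # q" "[z]"] have av: "avoids_231 (x # q)" by simp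
  with snoc have q: "q = filter (\<lambda>y. y < x) q @ filter (\<lambda>y. x < y) q" by simp
  show ?case
  proof (cases "z < x")
    case True
    have "\<not> x < y" if "y \<in> set q" for y
    proof
      assume "x < y"
      from that obtain i where "i < length q" "q ! i = y" by (auto simp: in_set_conv_nth)
      with True \<open>x < y\<close> avoids_231D[OF snoc.prems(1), of 0 "Suc i" "Suc (length q)"]
      show False by (simp add: nth_append)
    qed
    then have "filter (\<lambda>y. x < y) q = []" by (simp add: filter_empty_conv)
    with q True show ?thesis by simp
  next
    case False
    with snoc.prems(2) have "x < z" by auto
    with q show ?thesis by simp
  qed
qed simp

lemma perm_surj:
  assumes "set q = {a..<a + n}" "distinct q" "avoids_231 q"
  shows "\<exists>t. perm t a = q"
  using assms
proof (induction q arbitrary: a n rule: length_induct)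
  case (1 q)
  note q = 1(2-4)
  have IH: "\<exists>t. perm t b = p" if "length p < length q" "set p = {b..<b + k}" "distinct p" "avoids_231 p"
    for p b k using 1(1) that by blast
  show ?case
  proof (cases q)
    case Nil
    then show ?thesis by (metis perm.simps(1))
  next
    case (Cons x q')
    define p where "p = filter (\<lambda>y. y < x) q'"
    define r where "r = filter (\<lambda>y. x < y) q'"
    have q': "q' = p @ r"
      using avoids_231_Cons_split[of x q'] q Cons by (simp add: p_def r_def)
    have "x \<in> set q" using Cons by simp
    then have x: "a \<le> x" "x < a + n" using q(1) by auto
    have q'_set: "set q' = {a..<a + n} - {x}" using q(1,2) Cons by auto
    have p_set: "set p = {a..<a + (x - a)}"
      unfolding p_def set_filter q'_set using x by auto
    have r_set: "set r = {Suc x..<Suc x + (a + n - Suc x)}"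
      unfolding r_def set_filter q'_set using x by auto
    have dist: "distinct p" "distinct r" using q(2) Cons q' by simp_all
    have av: "avoids_231 p" "avoids_231 r"
      using q(3) Cons q' avoids_231_appendD[of "[x]" q'] avoids_231_appendD[of p r] by simp_all
    have "length p < length q" "length r < length q" using Cons q' by simp_all
    then obtain tp tr where t: "perm tp a = p" "perm tr (Suc x) = r"
      using IH[of p a] IH[of r "Suc x"] p_set r_set dist av by blast
    have "length p = x - a" using distinct_card[OF dist(1)] by (simp add: p_set)
    then have "a + size tp = x" using x t(1) length_perm[of tp a] by simp
    with t have "perm (Node tp tr) a = q" by (simp add: Cons q')
    then show ?thesis ..
  qed
qed

section \<open>The bijection \<open>phi\<close> obtained from the two tree encodings\<close>

lemma bij_betw_word: "bij_betw word {t. size t = n} {xs. restricted_ascent_seq xs \<and> length xs = n}"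
proof (rule bij_betw_imageI)
  show "inj_on word {t. size t = n}"
    \<comment> \<open>\<open>omega\<close> recovers \<open>perm t\<close> from
      \<open>word t\<close>, so injectivity is inherited from \<open>perm\<close>.\<close>
    by (intro inj_onI) (metis inj_perm word_props)
  show "word ` {t. size t = n} = {xs. restricted_ascent_seq xs \<and> length xs = n}"
    using word_props word_surj by (fastforce simp: image_iff)
qed

lemma bij_betw_perm:
  "bij_betw (\<lambda>t. perm t 1) {t. size t = n} {p \<in> permutations_of_set {1..n}. avoids_231 p}"
proof (rule bij_betw_imageI)
  show "inj_on (\<lambda>t. perm t 1) {t. size t = n}"
    by (intro inj_onI) (rule inj_perm)
  show "(\<lambda>t. perm t 1) ` {t. size t = n} = {p \<in> permutations_of_set {1..n}. avoids_231 p}"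
  proof (intro equalityI subsetI)
    fix p assume "p \<in> (\<lambda>t. perm t 1) ` {t. size t = n}"
    then obtain t where t: "size t = n" "p = perm t 1" by blast
    then have "set p = {1..n}" by (simp add: set_perm atLeastLessThanSuc_atLeastAtMost)
    with t show "p \<in> {p \<in> permutations_of_set {1..n}. avoids_231 p}"
      by (simp add: permutations_of_set_def distinct_perm avoids_231_perm)
  next
    fix p assume p: "p \<in> {p \<in> permutations_of_set {1..n}. avoids_231 p}"
    then have p': "set p = {1..<1 + n}" "distinct p" "avoids_231 p"
      by (simp_all add: permutations_of_set_def atLeastLessThanSuc_atLeastAtMost)
    from perm_surj[OF this] obtain t where t: "perm t 1 = p" ..
    have "length p = n" using distinct_card[OF p'(2)] by (simp add: p'(1))
    then have "size t = n" using t length_perm[of t 1] by simp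
    with t show "p \<in> (\<lambda>t. perm t 1) ` {t. size t = n}" by blast
  qed
qed

lemma bij_betw_phi:
  "bij_betw phi {xs. restricted_ascent_seq xs \<and> length xs = n}
     {p \<in> permutations_of_set {1..n}. avoids_231 p}"
proof -
  \<comment> \<open>\<open>phi\<close> after \<open>word\<close> is \<open>perm\<close> started at
    1; cancelling the bijection \<open>word\<close> then yields the claim.\<close>
  have "bij_betw (phi \<circ> word) {t. size t = n} {p \<in> permutations_of_set {1..n}. avoids_231 p}"
    using bij_betw_perm[of n] by (simp add: phi_def comp_def word_props)
  then show ?thesis using bij_betw_comp_iff[OF bij_betw_word] by blast
qed

lemma asc_eq_des_phi: "restricted_ascent_seq xs \<Longrightarrow> asc xs = des (phi xs)"
  using word_surj[of xs] word_props by (auto simp: phi_def des_perm)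

section \<open>Narayana numbers\<close>

abbreviation trees :: "nat \<Rightarrow> tree set" where
  "trees n \<equiv> {t. size t = n}"

lemma trees_0: "trees 0 = {Leaf}"
  by auto

lemma trees_Suc: "trees (Suc n) = (\<lambda>(l, r). Node l r) ` (SIGMA l:(\<Union>i\<le>n. trees i). trees (n - size l))"
proof (intro equalityI subsetI)
  fix t assume "t \<in> trees (Suc n)"
  then show "t \<in> (\<lambda>(l, r). Node l r) ` (SIGMA l:(\<Union>i\<le>n. trees i). trees (n - size l))"
    by (cases t) (auto simp: image_iff)
qed auto

lemma finite_trees: "finite (trees n)"
proof (induction n rule: less_induct)
  case (less n)
  show ?case
  proof (cases n)
    case 0
    then show ?thesis by (simp add: trees_0)
  next
    case (Suc m)
    with less show ?thesis unfolding Suc trees_Suc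
      by (intro finite_imageI finite_SigmaI) auto
  qed
qed

definition tree_poly :: "nat \<Rightarrow> int poly" where
  "tree_poly n = (\<Sum>t\<in>trees n. monom 1 (left_children t))"

lemma coeff_tree_poly: "coeff (tree_poly n) k = int (card {t. size t = n \<and> left_children t = k})"
proof -
  have "coeff (tree_poly n) k = (\<Sum>t\<in>trees n. if left_children t = k then 1 else 0)"
    by (simp add: tree_poly_def coeff_sum)
  also have "\<dots> = int (card (trees n \<inter> {t. left_children t = k}))"
    by (simp add: finite_trees sum.If_cases)
  also have "trees n \<inter> {t. left_children t = k} = {t. size t = n \<and> left_children t = k}" by auto
  finally show ?thesis .
qed

lemma tree_poly_0: "tree_poly 0 = 1"
  by (simp add: tree_poly_def trees_0)

lemma tree_poly_Suc:
  "tree_poly (Suc n) =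
     (\<Sum>i\<le>n. (if i = 0 then 1 else monom 1 1) * tree_poly i * tree_poly (n - i))"
proof -
  let ?w = "\<lambda>l :: tree. if l = Leaf then 1 else monom (1::int) 1"
  have "tree_poly (Suc n) =
      (\<Sum>(l, r)\<in>(SIGMA l:(\<Union>i\<le>n. trees i). trees (n - size l)).
         ?w l * monom 1 (left_children l) * monom 1 (left_children r))"
    unfolding tree_poly_def trees_Suc
    by (subst sum.reindex) (auto simp: inj_on_def mult_monom intro!: sum.cong)
  also have "\<dots> = (\<Sum>l\<in>(\<Union>i\<le>n. trees i). ?w l * monom 1 (left_children l) * tree_poly (n - size l))"
    by (subst sum.Sigma[symmetric]) (auto simp: finite_trees tree_poly_def sum_distrib_left)
  also have "\<dots> = (\<Sum>i\<le>n. \<Sum>l\<in>trees i. ?w l * monom 1 (left_children l) * tree_poly (n - size l))"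
    by (rule sum.UNION_disjoint) (auto simp: finite_trees)
  also have "\<dots> = (\<Sum>i\<le>n. (if i = 0 then 1 else monom 1 1) * tree_poly i * tree_poly (n - i))"
  proof (rule sum.cong)
    fix i
    have "(\<Sum>l\<in>trees i. ?w l * monom 1 (left_children l) * tree_poly (n - size l)) =
      (\<Sum>l\<in>trees i. (if i = 0 then 1 else monom 1 1) * monom 1 (left_children l) * tree_poly (n - i))"
      by (rule sum.cong) auto
    also have "\<dots> = (if i = 0 then 1 else monom 1 1) * tree_poly i * tree_poly (n - i)"
      by (simp add: tree_poly_def flip: sum_distrib_left sum_distrib_right)
    finally show "(\<Sum>l\<in>trees i. ?w l * monom 1 (left_children l) * tree_poly (n - size l)) =
      (if i = 0 then 1 else monom 1 1) * tree_poly i * tree_poly (n - i)" .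
  qed simp
  finally show ?thesis .
qed

text \<open>Weighted Motzkin paths of length \<open>m\<close> from height \<open>0\<close> to height \<open>h\<close>: an up step has weight
  $1$, a level step $1 + t$ and a down step $t$.\<close>

fun motzkin :: "nat \<Rightarrow> nat \<Rightarrow> int poly" where
  "motzkin 0 h = (if h = 0 then 1 else 0)"
| "motzkin (Suc m) h = (if h = 0 then 0 else motzkin m (h - 1)) +
     (1 + monom 1 1) * motzkin m h + monom 1 1 * motzkin m (Suc h)"

text \<open>Cut a path to height \<open>h + 1\<close> at its last step from height \<open>h\<close>.\<close>

lemma motzkin_Suc_height:
  "motzkin m (Suc h) = (\<Sum>i<m. motzkin i h * motzkin (m - Suc i) 0)"
proof (induction m arbitrary: h)
  case (Suc m)
  let ?D = "\<lambda>h. \<Sum>i<m. motzkin i h * motzkin (m - Suc i) 0"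
  have "(\<Sum>i<Suc m. motzkin i h * motzkin (Suc m - Suc i) 0) =
    motzkin 0 h * motzkin m 0 + (\<Sum>i<m. motzkin (Suc i) h * motzkin (m - Suc i) 0)"
    \<comment> \<open>The split-off term vanishes unless \<open>h = 0\<close>, where it supplies the
      up step from height 0; the step recursion applies to all others.\<close>
    by (subst sum.lessThan_Suc_shift) simp
  also have "(\<Sum>i<m. motzkin (Suc i) h * motzkin (m - Suc i) 0) =
    (if h = 0 then 0 else ?D (h - 1)) + (1 + monom 1 1) * ?D h + monom 1 1 * ?D (Suc h)"
    by (simp add: algebra_simps sum.distrib sum_distrib_left)
  also have "motzkin 0 h * motzkin m 0 + \<dots> = motzkin (Suc m) (Suc h)"
    by (cases h) (simp_all add: Suc.IH)
  finally show ?case by simp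
qed simp

text \<open>In the tree recursion the terms with empty left or empty right subtree give the final
  level step of weight \<open>1 + t\<close>. The remaining terms form the convolution for paths to
  height 1, followed by a down step.\<close>

lemma tree_poly_motzkin: "tree_poly (Suc m) = motzkin m 0"
proof (induction m rule: less_induct)
  case (less m)
  show ?case
  proof (cases m)
    case 0
    then show ?thesis by (simp add: tree_poly_Suc tree_poly_0)
  next
    case (Suc k)
    let ?x = "monom (1::int) 1"
    have "tree_poly (Suc m) = (\<Sum>i<Suc (Suc k).
        (if i = 0 then 1 else ?x) * tree_poly i * tree_poly (Suc k - i))"
      unfolding Suc tree_poly_Suc[of "Suc k"] lessThan_Suc_atMost ..
    also have "\<dots> = tree_poly m + (\<Sum>i<Suc k. ?x * tree_poly (Suc i) * tree_poly (k - i))"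
      by (subst sum.lessThan_Suc_shift) (simp add: tree_poly_0 Suc)
    also have "(\<Sum>i<Suc k. ?x * tree_poly (Suc i) * tree_poly (k - i)) =
        (\<Sum>i<k. ?x * tree_poly (Suc i) * tree_poly (Suc (k - Suc i))) + ?x * tree_poly m"
      by (simp add: tree_poly_0 Suc Suc_diff_Suc)
    also have "(\<Sum>i<k. ?x * tree_poly (Suc i) * tree_poly (Suc (k - Suc i))) =
        (\<Sum>i<k. ?x * (motzkin i 0 * motzkin (k - Suc i) 0))"
      by (intro sum.cong) (auto simp: less.IH Suc mult.assoc)
    also have "\<dots> = ?x * motzkin k (Suc 0)"
      by (simp add: motzkin_Suc_height[of k 0] sum_distrib_left)
    finally show ?thesis by (simp add: Suc less.IH[of k] algebra_simps)
  qed
qed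

lemma coeff_monom_1_mult: "coeff (monom 1 (Suc 0) * p) q = (if q = 0 then 0 else coeff p (q - 1))"
  for p :: "int poly"
  by (cases q) (simp_all add: monom_Suc coeff_pCons)

text \<open>Pairs of sets $A, B \subseteq \{1, \ldots, m\}$ of sizes $p \ge q - 1$ and $q$ such that every initial
  segment has at least as many elements in $A$ as in $B$, counted by reflection.\<close>

definition dominating_pairs :: "nat \<Rightarrow> nat \<Rightarrow> nat \<Rightarrow> int" where
  "dominating_pairs m p q = int (m choose p) * int (m choose q) -
     (if q = 0 then 0 else int (m choose Suc p) * int (m choose (q - 1)))"

lemma dominating_pairs_Suc_Suc:
  "dominating_pairs (Suc m) (Suc p) q = dominating_pairs m p q + dominating_pairs m (Suc p) q +
   (if q = 0 then 0 else dominating_pairs m p (q - 1) + dominating_pairs m (Suc p) (q - 1))"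
proof (cases q)
  case (Suc j)
  then show ?thesis by (cases j) (simp_all add: dominating_pairs_def algebra_simps)
qed (simp add: dominating_pairs_def)

text \<open>The boundary condition at height -1, which stands in for the missing up step into height
  0.\<close>

lemma dominating_pairs_diag: "dominating_pairs m j (Suc j) = 0"
  by (simp add: dominating_pairs_def)

text \<open>Step \<open>i\<close> of a path goes up if \<open>i\<close> is in $A - B$, down if it is in $B - A$, and level
  otherwise, where the level steps of weight $t$ are those in $A \cap B$.\<close>

lemma coeff_motzkin: "coeff (motzkin m h) q = dominating_pairs m (q + h) q"
proof (induction m arbitrary: h q)
  case 0
  then show ?case by (cases q; cases h) (auto simp: dominating_pairs_def)
next
  case (Suc m)
  have rec: "coeff (motzkin (Suc m) h) q =
      (if h = 0 then 0 else coeff (motzkin m (h - 1)) q) + coeff (motzkin m h) q +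
      (if q = 0 then 0 else coeff (motzkin m h) (q - 1)) +
      (if q = 0 then 0 else coeff (motzkin m (Suc h)) (q - 1))"
    by (simp add: distrib_right coeff_monom_1_mult)
  show ?case
  proof (cases "q + h")
    case 0
    then show ?thesis unfolding rec Suc.IH by (simp add: dominating_pairs_def)
  next
    case p: (Suc p)
    \<comment> \<open>The four terms of Pascal's rule place the new element in \<open>A\<close>
      only, in neither set, in both, or in \<open>B\<close> only, matching the four steps.\<close>
    show ?thesis unfolding rec Suc.IH p dominating_pairs_Suc_Suc
      using p by (cases h; cases q) (auto simp: dominating_pairs_diag)
  qed
qed

text \<open>All binomials are rational multiples of \<open>N choose k\<close>, which reduces the
  claim to \<open>(k + 1) * (N + 1 - k) - k * (N - k) = N + 1\<close>.\<close>

lemma narayana_eq: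
  assumes "k \<le> N"
  shows "real (N choose k) * real (N choose k) -
      (if k = 0 then 0 else real (N choose (k + 1)) * real (N choose (k - 1))) =
    narayana (Suc N) (k + 1)"
proof -
  let ?C = "real (N choose k)"
  have a: "real (Suc N choose Suc k) = (real N + 1) / (real k + 1) * ?C"
    using arg_cong[OF Suc_times_binomial_eq[of N k], of real] by (simp add: field_simps)
  have b: "real (Suc N choose k) = (real N + 1) / (real N + 1 - real k) * ?C"
    using arg_cong[OF binomial_absorb_comp[of "Suc N" k], of real] assms
    by (simp add: field_simps of_nat_diff)
  have shift: "(real j + 1) * real (N choose Suc j) = (real N - real j) * real (N choose j)"
    if "j \<le> N" for j
    using arg_cong[OF binomial_absorption[of j N], of real]
      arg_cong[OF binomial_absorb_comp[of N j], of real] that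
    by (simp add: of_nat_diff algebra_simps)
  have c: "real (N choose (k + 1)) = (real N - real k) / (real k + 1) * ?C"
    using shift[OF assms] by (simp add: field_simps)
  have d: "(if k = 0 then 0 else real (N choose (k - 1))) = real k / (real N + 1 - real k) * ?C"
    using shift[of "k - 1"] assms by (cases k) (simp_all add: field_simps)
  have "real (N choose k) * real (N choose k) -
      (if k = 0 then 0 else real (N choose (k + 1)) * real (N choose (k - 1))) =
    ?C * ?C - real (N choose (k + 1)) * (if k = 0 then 0 else real (N choose (k - 1)))"
    by simp
  also have "\<dots> = 1 / (real N + 1) * real (Suc N choose Suc k) * real (Suc N choose k)"
    unfolding a b c d using assms by (simp add: divide_simps) (simp add: algebra_simps)
  finally show ?thesis by (simp add: narayana_def add.commute)
qed

lemma card_trees_narayana: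
  assumes "n \<ge> 1" "k \<le> n - 1"
  shows "real (card {t. size t = n \<and> left_children t = k}) = narayana n (k + 1)"
proof -
  obtain N where n: "n = Suc N" using assms(1) by (cases n) auto
  have "real (card {t. size t = n \<and> left_children t = k}) = real_of_int (coeff (tree_poly n) k)"
    by (simp add: coeff_tree_poly)
  also have "tree_poly n = motzkin N 0" by (simp add: n tree_poly_motzkin)
  also have "real_of_int (coeff (motzkin N 0) k) = narayana n (k + 1)"
    using assms narayana_eq[of k N] by (cases k) (simp_all add: coeff_motzkin dominating_pairs_def n)
  finally show ?thesis .
qed

lemma card_restricted:
  "card {xs. restricted_ascent_seq xs \<and> length xs = n \<and> asc xs = k} =
   card {t. size t = n \<and> left_children t = k}"
proof -
  have "bij_betw word {t. size t = n \<and> left_children t = k}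
      {xs. restricted_ascent_seq xs \<and> length xs = n \<and> asc xs = k}"
    by (rule bij_betw_subset[OF bij_betw_word, of _ n, THEN bij_betw_cong[THEN iffD1, rotated]])
      (auto simp: image_iff word_props dest!: word_surj)
  then show ?thesis by (simp add: bij_betw_same_card)
qed

section \<open>Ascent sequences avoiding 021\<close>

text \<open>Both classes of words consist of the ascent sequences in which every letter below the
  maximum \<open>M\<close> of the preceding letters equals a prescribed number \<open>f M\<close>: it is \<open>M - 1\<close> for
  restricted ascent sequences and \<open>0\<close> for those avoiding 021.\<close>

definition low_letters :: "(nat \<Rightarrow> nat) \<Rightarrow> nat list \<Rightarrow> bool" where
  "low_letters f xs \<longleftrightarrow> ascent_seq xs \<and>
     (\<forall>i. 0 < i \<and> i < length xs \<longrightarrow>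
        Max (set (take i xs)) \<le> xs ! i \<or> xs ! i = f (Max (set (take i xs))))"

text \<open>The maxima are read off the original word; replacing low letters by values below these
  maxima does not change them.\<close>

definition relabel :: "(nat \<Rightarrow> nat) \<Rightarrow> nat list \<Rightarrow> nat list" where
  "relabel f xs = map (\<lambda>i. if i = 0 \<or> Max (set (take i xs)) \<le> xs ! i then xs ! i
                          else f (Max (set (take i xs)))) [0..<length xs]"

lemma low_lettersD:
  assumes "low_letters f xs" "0 < i" "i < length xs"
  shows "Max (set (take i xs)) \<le> xs ! i \<or> xs ! i = f (Max (set (take i xs)))"
  using assms by (simp add: low_letters_def del: Max.bounded_iff)

lemma low_letters_snoc:
  "low_letters f (xs @ [x]) \<longleftrightarrow>
     (if xs = [] then x = 0
      else low_letters f xs \<and> x \<le> asc xs + 1 \<and> (Max (set xs) \<le> x \<or> x = f (Max (set xs))))"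
  unfolding low_letters_def ascent_seq_snoc
    all_nth_snoc[where P = "\<lambda>ys y. Max (set ys) \<le> y \<or> y = f (Max (set ys))"]
  by auto

lemma relabel_Nil [simp]: "relabel f [] = []"
  by (simp add: relabel_def)

lemma relabel_snoc:
  "relabel f (xs @ [x]) =
     relabel f xs @ [if xs = [] \<or> Max (set xs) \<le> x then x else f (Max (set xs))]"
  by (simp add: relabel_def nth_append)

lemma length_relabel [simp]: "length (relabel f xs) = length xs"
  by (simp add: relabel_def)

lemma relabel_eq_Nil [simp]: "relabel f xs = [] \<longleftrightarrow> xs = []"
  by (simp flip: length_0_conv)

lemma Max_set_snoc: "xs \<noteq> [] \<Longrightarrow> Max (set (xs @ [x])) = max (Max (set xs)) x"
  by (simp add: max.commute)

text \<open>The clause on last letters carries the induction for \<open>asc\<close>: low letters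
  correspond to low letters and all others are kept, so the same positions are ascents.\<close>

lemma relabel_low_letters:
  assumes f: "\<And>M. 0 < M \<Longrightarrow> f M < M" and g: "\<And>M. 0 < M \<Longrightarrow> g M < M"
  assumes "low_letters f xs" "xs \<noteq> []"
  shows "low_letters g (relabel g xs) \<and> relabel f (relabel g xs) = xs \<and>
    asc (relabel g xs) = asc xs \<and> Max (set (relabel g xs)) = Max (set xs) \<and>
    (if last xs < Max (set xs)
     then last xs = f (Max (set xs)) \<and> last (relabel g xs) = g (Max (set xs))
     else last (relabel g xs) = last xs)"
  using assms(3,4)
proof (induction xs rule: rev_induct)
  case (snoc x xs)
  show ?case
  proof (cases "xs = []")
    case True
    with snoc.prems show ?thesis
      using relabel_snoc[of _ "[]" x] low_letters_snoc[of _ "[]" x] by simp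
  next
    case False
    define M where "M = Max (set xs)"
    define ys where "ys = relabel g xs"
    have ys: "ys \<noteq> []" using False by (simp add: ys_def)
    have x: "low_letters f xs" "x \<le> asc xs + 1" "M \<le> x \<or> x = f M"
      using snoc.prems False by (auto simp: low_letters_snoc M_def)
    then have IH: "low_letters g ys" "relabel f ys = xs" "asc ys = asc xs" "Max (set ys) = M"
      "if last xs < M then last xs = f M \<and> last ys = g M else last ys = last xs"
      using snoc.IH False by (simp_all add: M_def ys_def)
    have last: "last xs \<le> M" using False by (simp add: M_def)
    have "M \<in> set xs" using False by (simp add: M_def)
    then have M_asc: "M \<le> asc xs"
      using x(1) by (auto simp: low_letters_def intro: ascent_seq_le_asc)
    show ?thesis
    proof (cases "M \<le> x")
      case True
      then have rel: "relabel g (xs @ [x]) = ys @ [x]" by (simp add: relabel_snoc M_def ys_def)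
      have "last ys < x \<longleftrightarrow> last xs < x"
        using IH(5) True g[of M] by (auto split: if_splits)
      then show ?thesis unfolding rel Max_set_snoc[OF ys] Max_set_snoc[OF False]
        using IH x True False ys
        by (simp add: low_letters_snoc relabel_snoc asc_append flip: M_def)
    next
      case less: False
      with x have xf: "x = f M" by simp
      from less have "g M < M" using g by simp
      have rel: "relabel g (xs @ [x]) = ys @ [g M]"
        using less False by (simp add: relabel_snoc ys_def flip: M_def)
      \<comment> \<open>Each last letter is either the maximum \<open>M\<close> or already the
        prescribed low letter, so a low letter never creates an ascent.\<close>
      have "\<not> last xs < x" "\<not> last ys < g M"
        using IH(5) last less xf \<open>g M < M\<close> by (auto split: if_splits)
      then show ?thesis unfolding rel Max_set_snoc[OF ys] Max_set_snoc[OF False]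
        using IH less xf \<open>g M < M\<close> M_asc False ys
        by (simp add: low_letters_snoc relabel_snoc asc_append flip: M_def)
    qed
  qed
qed simp

lemma card_low_letters:
  assumes "\<And>M. 0 < M \<Longrightarrow> f M < M" "\<And>M. 0 < M \<Longrightarrow> g M < M" "n \<ge> 1"
  shows "card {xs. low_letters f xs \<and> length xs = n \<and> asc xs = k} =
    card {xs. low_letters g xs \<and> length xs = n \<and> asc xs = k}"
proof -
  have ne: "xs \<noteq> []" if "length xs = n" for xs :: "nat list" using that assms(3) by auto
  have "bij_betw (relabel g) {xs. low_letters f xs \<and> length xs = n \<and> asc xs = k}
      {xs. low_letters g xs \<and> length xs = n \<and> asc xs = k}"
    by (rule bij_betw_byWitness[where f' = "relabel f"])
      (use relabel_low_letters[of f g, OF assms(1,2)] relabel_low_letters[of g f, OF assms(2,1)] ne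
        in auto)
  then show ?thesis by (rule bij_betw_same_card)
qed

lemma restricted_low_letters: "restricted_ascent_seq xs \<longleftrightarrow> low_letters (\<lambda>M. M - 1) xs"
proof -
  have "M \<le> x + 1 \<longleftrightarrow> M \<le> x \<or> x = M - 1" for M x :: nat by auto
  then show ?thesis unfolding restricted_ascent_seq_def low_letters_def by metis
qed

text \<open>A positive letter below an earlier maximum forms a 021 with that maximum and the leading
  0. Conversely, the last letter of any 021 is positive and below the maximum before it.\<close>

lemma avoids_021_low_letters:
  "ascent_seq xs \<and> avoids_021 xs \<longleftrightarrow> low_letters (\<lambda>_. 0) xs"
proof (intro iffI)
  assume xs: "ascent_seq xs \<and> avoids_021 xs"
  have "Max (set (take i xs)) \<le> xs ! i \<or> xs ! i = 0" if i: "0 < i" "i < length xs" for i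
  proof (rule ccontr)
    let ?M = "Max (set (take i xs))"
    assume "\<not> (?M \<le> xs ! i \<or> xs ! i = 0)"
    then have less: "xs ! i < ?M" "0 < xs ! i" by auto
    have "?M \<in> set (take i xs)" using i by (intro Max_in) auto
    then obtain j where j: "j < i" "xs ! j = ?M" using i by (auto simp: in_set_conv_nth)
    have "xs ! 0 = 0" using xs i by (auto simp: ascent_seq_def)
    with j less have "0 < j" by (cases "j = 0") auto
    moreover have "xs ! 0 < xs ! i" "xs ! i < xs ! j" using less j \<open>xs ! 0 = 0\<close> by simp_all
    ultimately show False using xs j(1) i(2) unfolding avoids_021_def by blast
  qed
  with xs show "low_letters (\<lambda>_. 0) xs" by (simp add: low_letters_def)
next
  assume xs: "low_letters (\<lambda>_. 0) xs"
  have False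
    if i: "i1 < i2" "i2 < i3" "i3 < length xs" "xs ! i1 < xs ! i3" "xs ! i3 < xs ! i2" for i1 i2 i3
  proof -
    have "take i3 xs ! i2 \<in> set (take i3 xs)" using i(2,3) by (intro nth_mem) simp
    then have "xs ! i2 \<in> set (take i3 xs)" using i(2) by simp
    then have "xs ! i2 \<le> Max (set (take i3 xs))" by simp
    with i(4,5) have "\<not> Max (set (take i3 xs)) \<le> xs ! i3" "xs ! i3 \<noteq> 0" by linarith+
    moreover have "0 < i3" using i(1,2) by simp
    ultimately show False using low_lettersD[OF xs, of i3] i(3) by (simp del: Max.bounded_iff)
  qed
  then have "avoids_021 xs" unfolding avoids_021_def by blast
  with xs show "ascent_seq xs \<and> avoids_021 xs" by (simp add: low_letters_def)
qed

lemma card_avoids_021: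
  assumes "n \<ge> 1"
  shows "card {xs. ascent_seq xs \<and> avoids_021 xs \<and> length xs = n \<and> asc xs = k} =
    card {xs. restricted_ascent_seq xs \<and> length xs = n \<and> asc xs = k}"
  using card_low_letters[of "\<lambda>_. 0" "\<lambda>M. M - 1" n k] assms
  by (simp add: restricted_low_letters avoids_021_low_letters flip: conj_assoc)

theorem theorem2p15:
  fixes n :: nat
  assumes "n \<ge> 1"
  shows "bij_betw phi {xs. restricted_ascent_seq xs \<and> length xs = n}
           {p \<in> permutations_of_set {1..n}. avoids_231 p}
       \<and> (\<forall>xs. restricted_ascent_seq xs \<and> length xs = n \<longrightarrow> asc xs = des (phi xs))
       \<and> (\<forall>k. k \<le> n - 1 \<longrightarrow>
            real (card {xs. ascent_seq xs \<and> avoids_021 xs \<and> length xs = n \<and> asc xs = k})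
              = narayana n (k + 1)
          \<and> real (card {xs. restricted_ascent_seq xs \<and> length xs = n \<and> asc xs = k})
              = narayana n (k + 1))"
  using assms bij_betw_phi asc_eq_des_phi
  by (auto simp: card_avoids_021 card_restricted card_trees_narayana)

end
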